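(* Let $A_1, A_2, A_3 \in M_2(\mathbb{C})$ be any three self-adjoint matrices. Then the Clifford spectrum $\Lambda^{\mathrm{C}}(A_1,A_2,A_3) \subseteq \mathbb{R}^3$ is nonempty; that is, there exists $x=(x_1,x_2,x_3)\in\mathbb{R}^3$ such that the $4\times 4$ matrix $L_x(A_1,A_2,A_3)=\sum_{j=1}^3 (A_j-x_j\sigma_0)\otimes\sigma_j$ is not invertible.
   Context: Let $\sigma_0=\begin{bmatrix}1&0\\0&1\end{bmatrix}$, $\sigma_1=\begin{bmatrix}0&1\\1&0\end{bmatrix}$, $\sigma_2=\begin{bmatrix}0&-i\\i&0\end{bmatrix}$, $\sigma_3=\begin{bmatrix}1&0\\0&-1\end{bmatrix}$. For self-adjoint matrices $A_1,A_2,A_3\in M_2(\mathbb{C})$ and $x=(x_1,x_2,x_3)\in\mathbb{R}^3$, the (spectral) localizer is the $4\times 4$ matrix $L_x(A_1,A_2,A_3)=\sum_{j=1}^3 (A_j-x_j\sigma_0)\otimes\sigma_j$, where $\otimes$ is the Kronecker product. The Clifford spectrum is $\Lambda^{\mathrm{C}}(A_1,A_2,A_3)=\{x\in\mathbb{R}^3 : L_x(A_1,A_2,A_3)\text{ is not invertible}\}$. *)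

theory Defs
  imports "HOL-Analysis.Analysis"
begin

definition conj_transpose :: "complex^'n^'m \<Rightarrow> complex^'m^'n" where
  "conj_transpose A = (\<chi> i j. cnj (A $ j $ i))"

definition self_adjoint :: "complex^'n^'n \<Rightarrow> bool" where
  "self_adjoint A \<longleftrightarrow> conj_transpose A = A"

text \<open>The rows and columns of a Kronecker product are indexed by pairs: the first component
  is the position of the block, the second the position inside the block. For two
  \<open>2 \<times> 2\<close> matrices the index type is \<open>2 \<times> 2\<close>, with four elements, and listing the
  pairs lexicographically gives the usual \<open>4 \<times> 4\<close> block matrix.\<close>

definition kronecker :: "'a::times^'n^'m \<Rightarrow> 'a^'k^'l \<Rightarrow> 'a^('n \<times> 'k)^('m \<times> 'l)"
    (infixl \<open>\<otimes>\<^sub>K\<close> 70) where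
  "A \<otimes>\<^sub>K B = (\<chi> p q. A $ fst p $ fst q * B $ snd p $ snd q)"

definition sigma0 :: "complex^2^2" where
  "sigma0 = vector [vector [1, 0], vector [0, 1]]"

definition sigma1 :: "complex^2^2" where
  "sigma1 = vector [vector [0, 1], vector [1, 0]]"

definition sigma2 :: "complex^2^2" where
  "sigma2 = vector [vector [0, - \<i>], vector [\<i>, 0]]"

definition sigma3 :: "complex^2^2" where
  "sigma3 = vector [vector [1, 0], vector [0, - 1]]"

definition localizer ::
    "complex^2^2 \<Rightarrow> complex^2^2 \<Rightarrow> complex^2^2 \<Rightarrow> real^3 \<Rightarrow> complex^(2 \<times> 2)^(2 \<times> 2)" where
  "localizer A1 A2 A3 x =
     (A1 - x $ 1 *\<^sub>R sigma0) \<otimes>\<^sub>K sigma1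
   + (A2 - x $ 2 *\<^sub>R sigma0) \<otimes>\<^sub>K sigma2
   + (A3 - x $ 3 *\<^sub>R sigma0) \<otimes>\<^sub>K sigma3"

definition clifford_spectrum ::
    "complex^2^2 \<Rightarrow> complex^2^2 \<Rightarrow> complex^2^2 \<Rightarrow> (real^3) set" where
  "clifford_spectrum A1 A2 A3 = {x. \<not> invertible (localizer A1 A2 A3 x)}"

end

theory Submission
  imports Defs
begin

text \<open>Since the Pauli matrices are a basis of the self-adjoint matrices, \<open>A\<^sub>j = m\<^sub>j \<sigma>\<^sub>0 + b\<^sub>j \<sigma>\<^sub>1 + c\<^sub>j \<sigma>\<^sub>2 + a\<^sub>j \<sigma>\<^sub>3\<close>
  with real vectors \<open>m, a, b, c\<close> in \<open>\<real>\<^sup>3\<close>. The scalar parts \<open>m\<close> only translate the spectrum, and with \<open>y = x - m\<close>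
  the determinant of the localizer is a real quartic in \<open>y\<close> (lemma \<open>det_localizer\<close>):
  \<open>p(y) = (\<bar>y\<bar>\<^sup>2 + T)\<^sup>2 - 4 q(y) - 4 e\<close>. Here \<open>G = a a\<^sup>t + b b\<^sup>t + c c\<^sup>t\<close> is a positive
  semidefinite operator, \<open>q(y) = y \<bullet> G y\<close>, \<open>T\<close> is the trace of \<open>G\<close>, and \<open>e\<close> is the second
  elementary symmetric function of its eigenvalues, that is, the sum of the principal \<open>2 \<times> 2\<close> minors of the
  Gram matrix of \<open>a, b, c\<close>.

  Far from the origin \<open>p\<close> is nonnegative, so by the intermediate value theorem a zero exists as soon as
  \<open>p\<close> takes a nonpositive value. Let \<open>\<lambda>\<close> be the largest eigenvalue of \<open>G\<close>, with unit
  eigenvector \<open>v\<close>. If \<open>T \<le> 2 \<lambda>\<close>, then along the line of \<open>v\<close> the quartic is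
  smallest where \<open>\<bar>y\<bar>\<^sup>2 = 2 \<lambda> - T\<close>, and its value there is \<open>4 (\<lambda> (T - \<lambda>) - e)\<close>.
  This is minus four times the product of the other two eigenvalues, hence nonpositive.
  If \<open>T > 2 \<lambda>\<close>, the origin works, because
  \<open>p(0) = 2 tr G\<^sup>2 - T\<^sup>2\<close> and \<open>tr G\<^sup>2 \<le> \<lambda> T < T\<^sup>2 / 2\<close>.

  The middle step needs no spectral theorem: \<open>v\<close> is a maximizer of \<open>q\<close> on the unit sphere,
  the first-order condition makes it an eigenvector, and the inequality \<open>\<lambda> (T - \<lambda>) \<le> e\<close>
  follows by splitting \<open>a, b, c\<close> along \<open>v\<close> and its orthogonal complement.\<close>

section \<open>The quartic of three vectors\<close>

text \<open>With \<open>G = a a\<^sup>t + b b\<^sup>t + c c\<^sup>t\<close>, the next three functions are the quadratic form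
  \<open>y \<bullet> G y\<close>, the trace of \<open>G\<close>, and the second elementary symmetric function of the eigenvalues of \<open>G\<close>.\<close>

definition gram_form :: "'a::real_inner \<Rightarrow> 'a \<Rightarrow> 'a \<Rightarrow> 'a \<Rightarrow> real" where
  "gram_form a b c y = (y \<bullet> a)\<^sup>2 + (y \<bullet> b)\<^sup>2 + (y \<bullet> c)\<^sup>2"

definition gram_trace :: "'a::real_inner \<Rightarrow> 'a \<Rightarrow> 'a \<Rightarrow> real" where
  "gram_trace a b c = a \<bullet> a + b \<bullet> b + c \<bullet> c"

definition gram_minors :: "'a::real_inner \<Rightarrow> 'a \<Rightarrow> 'a \<Rightarrow> real" where
  "gram_minors a b c = ((a \<bullet> a) * (b \<bullet> b) - (a \<bullet> b)\<^sup>2)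
     + ((a \<bullet> a) * (c \<bullet> c) - (a \<bullet> c)\<^sup>2) + ((b \<bullet> b) * (c \<bullet> c) - (b \<bullet> c)\<^sup>2)"

definition clifford_quartic :: "'a::real_inner \<Rightarrow> 'a \<Rightarrow> 'a \<Rightarrow> 'a \<Rightarrow> real" where
  "clifford_quartic a b c y =
     (y \<bullet> y + gram_trace a b c)\<^sup>2 - 4 * gram_form a b c y - 4 * gram_minors a b c"

lemma gram_form_maximizer:
  fixes a b c :: "'a::euclidean_space"
  obtains v where "v \<bullet> v = 1" "\<And>y. gram_form a b c y \<le> gram_form a b c v * (y \<bullet> y)"
proof -
  have "continuous_on (sphere 0 1) (gram_form a b c)"
    unfolding gram_form_def by (intro continuous_intros)
  moreover have "sphere (0::'a) 1 \<noteq> {}" by simp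
  ultimately obtain v where v: "norm v = 1" "\<And>u. norm u = 1 \<Longrightarrow> gram_form a b c u \<le> gram_form a b c v"
    using continuous_attains_sup[OF compact_sphere] by (metis mem_sphere_0)
  have "gram_form a b c y \<le> gram_form a b c v * (y \<bullet> y)" for y
  proof (cases "y = 0")
    case False
    have "gram_form a b c y = gram_form a b c (y /\<^sub>R norm y) * (norm y)\<^sup>2"
      using False by (simp add: gram_form_def field_simps)
    also have "\<dots> \<le> gram_form a b c v * (norm y)\<^sup>2"
      using False by (intro mult_right_mono v) auto
    finally show ?thesis by (simp add: power2_norm_eq_inner)
  qed (simp add: gram_form_def)
  then show thesis using that v by (metis norm_eq_1)
qed

text \<open>The form \<open>\<lambda> \<bar>y\<bar>\<^sup>2 - q(y)\<close> is nonnegative and vanishes at \<open>v\<close>. A nonzero residual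
  \<open>r = G v - \<lambda> v\<close> would be a direction along which it decreases from \<open>v\<close> to first order.\<close>

lemma gram_form_maximizer_is_eigenvector:
  fixes a b c v :: "'a::real_inner"
  assumes "v \<bullet> v = 1" and max: "\<And>y. gram_form a b c y \<le> gram_form a b c v * (y \<bullet> y)"
  shows "(v \<bullet> a) *\<^sub>R a + (v \<bullet> b) *\<^sub>R b + (v \<bullet> c) *\<^sub>R c = gram_form a b c v *\<^sub>R v"
proof -
  define l where "l = gram_form a b c v"
  define r where "r = (v \<bullet> a) *\<^sub>R a + (v \<bullet> b) *\<^sub>R b + (v \<bullet> c) *\<^sub>R c - l *\<^sub>R v"
  have l: "l \<ge> 0" by (simp add: l_def gram_form_def)
  have rr: "(v \<bullet> a) * (r \<bullet> a) + (v \<bullet> b) * (r \<bullet> b) + (v \<bullet> c) * (r \<bullet> c) = r \<bullet> r + l * (v \<bullet> r)"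
    by (subst (4) r_def) (simp add: inner_simps inner_commute[of _ r])
  \<comment> \<open>The step \<open>s r\<close> changes \<open>\<lambda> \<bar>y\<bar>\<^sup>2 - q(y)\<close> by at most \<open>- 2 s \<bar>r\<bar>\<^sup>2 + s\<^sup>2 \<lambda> \<bar>r\<bar>\<^sup>2\<close>; it must be so short
    that the linear term dominates.\<close>
  define s where "s = 1 / (l + 1)"
  have s: "s > 0" "s * l < 1" using l by (auto simp: s_def field_simps)
  have "gram_form a b c (v + s *\<^sub>R r) = l + 2 * s * (r \<bullet> r + l * (v \<bullet> r)) + s\<^sup>2 * gram_form a b c r"
    unfolding rr[symmetric] by (simp add: l_def gram_form_def inner_simps power2_eq_square algebra_simps)
  moreover have "gram_form a b c (v + s *\<^sub>R r) \<le> l + 2 * s * l * (v \<bullet> r) + s\<^sup>2 * (l * (r \<bullet> r))"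
    using max[of "v + s *\<^sub>R r"] assms(1)
    by (simp add: l_def inner_simps inner_commute[of r v] power2_eq_square algebra_simps)
  moreover have "s\<^sup>2 * gram_form a b c r \<ge> 0" by (simp add: gram_form_def)
  ultimately have "2 * s * (r \<bullet> r) \<le> s\<^sup>2 * (l * (r \<bullet> r))" by (simp add: algebra_simps)
  then have "s * ((2 - s * l) * (r \<bullet> r)) \<le> 0" by (simp add: power2_eq_square algebra_simps)
  then have "r \<bullet> r \<le> 0" using s by (simp add: mult_le_0_iff)
  then have "r = 0" using inner_gt_zero_iff[of r] by linarith
  then show ?thesis by (simp add: r_def l_def)
qed

lemma gram_minors_nonneg: "gram_minors a b c \<ge> 0"
  unfolding gram_minors_def by (intro add_nonneg_nonneg) (simp_all add: Cauchy_Schwarz_ineq)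

text \<open>If \<open>\<lambda>, \<mu>, \<nu>\<close> are the eigenvalues of \<open>G\<close> in dimension three, this says \<open>\<lambda> (\<mu> + \<nu>) \<le> \<lambda> \<mu> + \<lambda> \<nu> + \<mu> \<nu>\<close>.
  The difference \<open>\<mu> \<nu>\<close> is the sum of Gram minors of the components of \<open>a, b, c\<close> orthogonal to \<open>v\<close>.\<close>

lemma gram_minors_ge:
  fixes a b c v :: "'a::real_inner"
  assumes v: "v \<bullet> v = 1"
    and eig: "(v \<bullet> a) *\<^sub>R a + (v \<bullet> b) *\<^sub>R b + (v \<bullet> c) *\<^sub>R c = gram_form a b c v *\<^sub>R v"
  shows "gram_form a b c v * (gram_trace a b c - gram_form a b c v) \<le> gram_minors a b c"
proof -
  define \<alpha> \<beta> \<gamma> where ab: "\<alpha> = v \<bullet> a" "\<beta> = v \<bullet> b" "\<gamma> = v \<bullet> c"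
  define a' b' c' where "a' = a - \<alpha> *\<^sub>R v" and "b' = b - \<beta> *\<^sub>R v" and "c' = c - \<gamma> *\<^sub>R v"
  then have a: "a = \<alpha> *\<^sub>R v + a'" and b: "b = \<beta> *\<^sub>R v + b'" and c: "c = \<gamma> *\<^sub>R v + c'" by auto
  have o: "v \<bullet> a' = 0" "v \<bullet> b' = 0" "v \<bullet> c' = 0"
    by (simp_all add: a'_def b'_def c'_def inner_simps v ab)
  have o': "a' \<bullet> v = 0" "b' \<bullet> v = 0" "c' \<bullet> v = 0" using o by (simp_all add: inner_commute)
  have q: "gram_form a b c v = \<alpha>\<^sup>2 + \<beta>\<^sup>2 + \<gamma>\<^sup>2" by (simp add: gram_form_def ab)
  \<comment> \<open>The eigenvector equation, projected to the orthogonal complement of \<open>v\<close>, says \<open>w = 0\<close>;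
    expanding \<open>\<bar>w\<bar>\<^sup>2 = 0\<close> disposes of the cross terms in the minors.\<close>
  define w where "w = \<alpha> *\<^sub>R a' + \<beta> *\<^sub>R b' + \<gamma> *\<^sub>R c'"
  have "w = 0"
    using eig unfolding q ab[symmetric] w_def a'_def b'_def c'_def
    by (simp add: algebra_simps power2_eq_square)
  then have "w \<bullet> w = 0" by simp
  then have w: "\<alpha>\<^sup>2 * (a' \<bullet> a') + \<beta>\<^sup>2 * (b' \<bullet> b') + \<gamma>\<^sup>2 * (c' \<bullet> c')
      + 2 * (\<alpha> * \<beta> * (a' \<bullet> b') + \<alpha> * \<gamma> * (a' \<bullet> c') + \<beta> * \<gamma> * (b' \<bullet> c')) = 0"
    by (simp add: w_def inner_simps inner_commute[of b' a'] inner_commute[of c' a']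
        inner_commute[of c' b'] power2_eq_square algebra_simps)
  have i: "a \<bullet> a = \<alpha>\<^sup>2 + a' \<bullet> a'" "b \<bullet> b = \<beta>\<^sup>2 + b' \<bullet> b'" "c \<bullet> c = \<gamma>\<^sup>2 + c' \<bullet> c'"
    "a \<bullet> b = \<alpha> * \<beta> + a' \<bullet> b'" "a \<bullet> c = \<alpha> * \<gamma> + a' \<bullet> c'" "b \<bullet> c = \<beta> * \<gamma> + b' \<bullet> c'"
    by (simp_all add: a b c inner_simps v o o' power2_eq_square)
  have "gram_minors a b c = gram_form a b c v * (gram_trace a b c - gram_form a b c v) + gram_minors a' b' c'"
    unfolding gram_minors_def gram_trace_def q i using w by algebra
  then show ?thesis using gram_minors_nonneg[of a' b' c'] by simp
qed

text \<open>Newton's identity \<open>2 e = (tr G)\<^sup>2 - tr G\<^sup>2\<close>, where \<open>tr G\<^sup>2\<close> is obtained by summing the form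
  over \<open>a, b, c\<close>.\<close>

lemma twice_gram_minors:
  "2 * gram_minors a b c =
    (gram_trace a b c)\<^sup>2 - (gram_form a b c a + gram_form a b c b + gram_form a b c c)"
  by (simp add: gram_minors_def gram_trace_def gram_form_def inner_commute power2_eq_square algebra_simps)

lemma clifford_quartic_nonpos:
  fixes a b c :: "'a::euclidean_space"
  shows "\<exists>y. clifford_quartic a b c y \<le> 0"
proof -
  obtain v where v: "v \<bullet> v = 1" "\<And>y. gram_form a b c y \<le> gram_form a b c v * (y \<bullet> y)"
    using gram_form_maximizer by blast
  define l where "l = gram_form a b c v"
  show ?thesis
  proof (cases "gram_trace a b c \<le> 2 * l")
    case True
    \<comment> \<open>On the line of \<open>v\<close>, with \<open>\<tau> = \<bar>y\<bar>\<^sup>2\<close>, the quartic is \<open>(\<tau> + T)\<^sup>2 - 4 \<lambda> \<tau> - 4 e\<close>, which is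
      smallest at \<open>\<tau> = 2 \<lambda> - T\<close>.\<close>
    define y where "y = sqrt (2 * l - gram_trace a b c) *\<^sub>R v"
    have "y \<bullet> y = 2 * l - gram_trace a b c" "gram_form a b c y = (2 * l - gram_trace a b c) * l"
      using True v(1) by (simp_all add: y_def l_def gram_form_def power_mult_distrib algebra_simps)
    then have "clifford_quartic a b c y = 4 * (l * (gram_trace a b c - l) - gram_minors a b c)"
      by (simp add: clifford_quartic_def power2_eq_square algebra_simps)
    also have "\<dots> \<le> 0"
      using gram_minors_ge[OF v(1) gram_form_maximizer_is_eigenvector[OF v]] by (simp add: l_def)
    finally show ?thesis ..
  next
    case False
    have "gram_form a b c a + gram_form a b c b + gram_form a b c c \<le> l * gram_trace a b c"
      using v(2)[of a] v(2)[of b] v(2)[of c] by (simp add: l_def gram_trace_def algebra_simps)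
    moreover have "2 * (l * gram_trace a b c) \<le> (gram_trace a b c)\<^sup>2"
      using False by (simp add: gram_trace_def power2_eq_square mult_right_mono flip: mult.assoc)
    ultimately have "clifford_quartic a b c 0 \<le> 0"
      using twice_gram_minors[of a b c] by (simp add: clifford_quartic_def gram_form_def[of _ _ _ 0])
    then show ?thesis ..
  qed
qed

text \<open>At this radius the square term of the quartic is \<open>16 T\<^sup>2\<close>, which outweighs
  \<open>4 q(y) \<le> 4 \<bar>y\<bar>\<^sup>2 T = 12 T\<^sup>2\<close> together with \<open>4 e \<le> 2 T\<^sup>2\<close>.\<close>

lemma clifford_quartic_nonneg:
  assumes "y \<bullet> y = 3 * gram_trace a b c"
  shows "clifford_quartic a b c y \<ge> 0"
proof -
  have "gram_form a b c y \<le> (y \<bullet> y) * gram_trace a b c"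
    unfolding gram_form_def gram_trace_def by (simp add: distrib_left add_mono Cauchy_Schwarz_ineq)
  moreover have "2 * gram_minors a b c \<le> (gram_trace a b c)\<^sup>2"
    unfolding twice_gram_minors by (smt (verit) gram_form_def zero_le_power2)
  moreover have "(y \<bullet> y + gram_trace a b c)\<^sup>2 = 16 * (gram_trace a b c)\<^sup>2"
      "y \<bullet> y * gram_trace a b c = 3 * (gram_trace a b c)\<^sup>2"
    by (simp_all add: assms power2_eq_square)
  ultimately show ?thesis using zero_le_power2[of "gram_trace a b c"]
    unfolding clifford_quartic_def by linarith
qed

lemma clifford_quartic_zero:
  fixes a b c :: "'a::euclidean_space"
  shows "\<exists>y. clifford_quartic a b c y = 0"
proof -
  obtain y where y: "clifford_quartic a b c y \<le> 0" using clifford_quartic_nonpos by blast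
  define z :: 'a where "z = sqrt (3 * gram_trace a b c) *\<^sub>R (SOME i. i \<in> Basis)"
  have "z \<bullet> z = 3 * gram_trace a b c" by (simp add: z_def gram_trace_def SOME_Basis)
  then have z: "clifford_quartic a b c z \<ge> 0" by (rule clifford_quartic_nonneg)
  have "connected (range (clifford_quartic a b c))"
    by (intro connected_continuous_image connected_UNIV)
       (auto simp: clifford_quartic_def gram_form_def intro!: continuous_intros)
  then have "0 \<in> range (clifford_quartic a b c)"
    using connectedD_interval[OF _ rangeI[of _ y] rangeI[of _ z] y z] by blast
  then show ?thesis by (metis rangeE)
qed

section \<open>Determinants of two-by-two blocks\<close>

text \<open>The Laplace expansion along the rows \<open>i, j\<close>, on an index type that is only known by its four
  elements: the Kronecker product is indexed by pairs.\<close>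

lemma det_four:
  fixes M :: "'a::comm_ring_1 ^ 'n ^ 'n"
  assumes "UNIV = {i, j, k, l}" "distinct [i, j, k, l]"
  shows "det M =
    (M$i$i * M$j$j - M$i$j * M$j$i) * (M$k$k * M$l$l - M$k$l * M$l$k)
  - (M$i$i * M$j$k - M$i$k * M$j$i) * (M$k$j * M$l$l - M$k$l * M$l$j)
  + (M$i$i * M$j$l - M$i$l * M$j$i) * (M$k$j * M$l$k - M$k$k * M$l$j)
  + (M$i$j * M$j$k - M$i$k * M$j$j) * (M$k$i * M$l$l - M$k$l * M$l$i)
  - (M$i$j * M$j$l - M$i$l * M$j$j) * (M$k$i * M$l$k - M$k$k * M$l$i)
  + (M$i$k * M$j$l - M$i$l * M$j$k) * (M$k$i * M$l$j - M$k$j * M$l$i)"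
proof -
  have f: "finite {j, k, l}" "i \<notin> {j, k, l}" "finite {k, l}" "j \<notin> {k, l}" "finite {l}" "k \<notin> {l}"
    using assms(2) by auto
  have ne: "i \<noteq> j" "i \<noteq> k" "i \<noteq> l" "j \<noteq> k" "j \<noteq> l" "k \<noteq> l" using assms(2) by auto
  show ?thesis
    unfolding det_def assms(1)
    unfolding sum_over_permutations_insert[OF f(1,2)]
    unfolding sum_over_permutations_insert[OF f(3,4)]
    unfolding sum_over_permutations_insert[OF f(5,6)]
    unfolding permutes_sing
    by (simp add: sign_swap_id sign_compose permutation_swap_id permutation_compose sign_id ne ne[symmetric]
     Transposition.transpose_apply_other) (simp only: algebra_simps)
qed

definition block_matrix :: "'a^2^2 \<Rightarrow> 'a^2^2 \<Rightarrow> 'a^2^2 \<Rightarrow> 'a^2^2 \<Rightarrow> 'a^(2 \<times> 2)^(2 \<times> 2)" where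
  "block_matrix P Q R S = (\<chi> i j.
     (if fst i = 1 then if fst j = 1 then P else Q else if fst j = 1 then R else S) $ snd i $ snd j)"

text \<open>For arbitrary \<open>2 \<times> 2\<close> blocks
  \<open>det = det P det S + det Q det R - tr (adj P Q adj S R)\<close>. A traceless block satisfies
  \<open>adj P = - P\<close>, and the trace of a product of four traceless blocks is determined by the traces of
  the pairwise products.\<close>

lemma det_block_matrix_traceless:
  fixes P Q R S :: "'a::comm_ring_1^2^2"
  assumes "P $ 2 $ 2 = - P $ 1 $ 1" "Q $ 2 $ 2 = - Q $ 1 $ 1"
    and "R $ 2 $ 2 = - R $ 1 $ 1" "S $ 2 $ 2 = - S $ 1 $ 1"
  shows "2 * det (block_matrix P Q R S) = 2 * det P * det S + 2 * det Q * det R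
    + trace (P ** S) * trace (Q ** R) - trace (P ** Q) * trace (R ** S) - trace (P ** R) * trace (Q ** S)"
proof -
  have U: "(UNIV :: (2 \<times> 2) set) = {(1, 1), (1, 2), (2, 1), (2, 2)}"
    by (auto simp: UNIV_Times_UNIV[symmetric] UNIV_2 simp del: UNIV_Times_UNIV)
  have d: "distinct [(1, 1), (1, 2), (2, 1), (2, 2) :: 2 \<times> 2]" by simp
  show ?thesis
    unfolding det_four[OF U d]
    by (simp add: block_matrix_def trace_def matrix_matrix_mult_def sum_2 det_2 assms)
       (simp add: algebra_simps)
qed

section \<open>The determinant of the localizer\<close>

text \<open>This is \<open>w\<^sub>1 \<sigma>\<^sub>1 + w\<^sub>2 \<sigma>\<^sub>2 + w\<^sub>3 \<sigma>\<^sub>3\<close>.\<close>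

definition pauli :: "complex^3 \<Rightarrow> complex^2^2" where
  "pauli w = vector [vector [w $ 3, w $ 1 - \<i> * w $ 2], vector [w $ 1 + \<i> * w $ 2, - w $ 3]]"

definition complex_vec :: "real^'n \<Rightarrow> real^'n \<Rightarrow> complex^'n" where
  "complex_vec u v = (\<chi> j. Complex (u $ j) (v $ j))"

lemma trace_pauli_mult:
  "trace (pauli (complex_vec u u') ** pauli (complex_vec v v')) =
     2 * Complex (u \<bullet> v - u' \<bullet> v') (u \<bullet> v' + u' \<bullet> v)"
  by (simp add: pauli_def complex_vec_def trace_def matrix_matrix_mult_def sum_2 inner_vec_def sum_3
      complex_eq_iff algebra_simps)

lemma det_pauli:
  "det (pauli (complex_vec u u')) = - Complex (u \<bullet> u - u' \<bullet> u') (2 * (u \<bullet> u'))"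
  by (simp add: pauli_def complex_vec_def det_2 inner_vec_def sum_3 complex_eq_iff algebra_simps)

lemma self_adjoint_pauli_coordinates:
  assumes "self_adjoint A"
  obtains m a b c where "A = m *\<^sub>R sigma0 + b *\<^sub>R sigma1 + c *\<^sub>R sigma2 + a *\<^sub>R sigma3"
proof -
  have "cnj (A $ j $ i) = A $ i $ j" for i j
    using assms by (simp add: self_adjoint_def conj_transpose_def vec_eq_iff)
  from this[of 1 1] this[of 2 2] this[of 1 2]
  have "A = ((Re (A$1$1) + Re (A$2$2)) / 2) *\<^sub>R sigma0 + Re (A$1$2) *\<^sub>R sigma1
      + (- Im (A$1$2)) *\<^sub>R sigma2 + ((Re (A$1$1) - Re (A$2$2)) / 2) *\<^sub>R sigma3"
    by (simp add: vec_eq_iff forall_2 sigma0_def sigma1_def sigma2_def sigma3_def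
        complex_eq_iff field_simps)
  then show thesis by (rule that)
qed

text \<open>Collecting the entries of \<open>A\<^sub>1, A\<^sub>2, A\<^sub>3\<close> at one position gives a complex vector, and the block
  of the localizer at that position is its Pauli matrix. All blocks are therefore traceless, and the
  determinant depends only on the bilinear products of the four vectors.\<close>

lemma det_localizer:
  fixes a b c m x :: "real^3"
  defines "A \<equiv> \<lambda>j. m $ j *\<^sub>R sigma0 + b $ j *\<^sub>R sigma1 + c $ j *\<^sub>R sigma2 + a $ j *\<^sub>R sigma3"
  shows "det (localizer (A 1) (A 2) (A 3) x) = of_real (clifford_quartic a b c (x - m))"
proof -
  define y where "y = x - m"
  then have x: "x = m + y" by simp
  let ?P = "pauli (complex_vec (a - y) 0)" and ?S = "pauli (complex_vec (- a - y) 0)"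
  let ?Q = "pauli (complex_vec b (- c))" and ?R = "pauli (complex_vec b c)"
  have L: "localizer (A 1) (A 2) (A 3) x = block_matrix ?P ?Q ?R ?S"
    by (simp add: vec_eq_iff forall_2 localizer_def kronecker_def block_matrix_def A_def x
        pauli_def complex_vec_def sigma0_def sigma1_def sigma2_def sigma3_def
        complex_eq_iff algebra_simps)
  have t: "pauli w $ 2 $ 2 = - pauli w $ 1 $ 1" for w by (simp add: pauli_def)
  have "2 * det (localizer (A 1) (A 2) (A 3) x) = 2 * of_real (clifford_quartic a b c y)"
    unfolding L det_block_matrix_traceless[OF t t t t] trace_pauli_mult det_pauli
    by (simp add: clifford_quartic_def gram_form_def gram_trace_def gram_minors_def complex_eq_iff
        inner_simps inner_commute[of b a] inner_commute[of c a] inner_commute[of c b]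
        inner_commute[of a y] inner_commute[of b y] inner_commute[of c y]
        power2_eq_square algebra_simps)
  then show ?thesis by (simp add: y_def)
qed

theorem theorem2p4:
  fixes A1 A2 A3 :: "complex^2^2"
  assumes "self_adjoint A1" and "self_adjoint A2" and "self_adjoint A3"
  shows "clifford_spectrum A1 A2 A3 \<noteq> {}"
proof -
  obtain m1 a1 b1 c1 where A1: "A1 = m1 *\<^sub>R sigma0 + b1 *\<^sub>R sigma1 + c1 *\<^sub>R sigma2 + a1 *\<^sub>R sigma3"
    using assms(1) by (rule self_adjoint_pauli_coordinates)
  obtain m2 a2 b2 c2 where A2: "A2 = m2 *\<^sub>R sigma0 + b2 *\<^sub>R sigma1 + c2 *\<^sub>R sigma2 + a2 *\<^sub>R sigma3"
    using assms(2) by (rule self_adjoint_pauli_coordinates)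
  obtain m3 a3 b3 c3 where A3: "A3 = m3 *\<^sub>R sigma0 + b3 *\<^sub>R sigma1 + c3 *\<^sub>R sigma2 + a3 *\<^sub>R sigma3"
    using assms(3) by (rule self_adjoint_pauli_coordinates)
  define m a b c :: "real^3"
    where "m = vector [m1, m2, m3]" and "a = vector [a1, a2, a3]"
      and "b = vector [b1, b2, b3]" and "c = vector [c1, c2, c3]"
  obtain y where "clifford_quartic a b c y = 0"
    using clifford_quartic_zero by blast
  moreover have "det (localizer A1 A2 A3 (m + y)) = of_real (clifford_quartic a b c y)"
    using det_localizer[of m b c a "m + y"]
    by (simp add: A1 A2 A3 m_def a_def b_def c_def)
  ultimately have "m + y \<in> clifford_spectrum A1 A2 A3"
    by (simp add: clifford_spectrum_def invertible_det_nz)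
  then show ?thesis by blast
qed

end
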